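(* Apply the Global Solution Algorithm described in the context to the problem (OVR). Then the algorithm either stops at a global solution of (OVR), or the computed sequence $(\beta_k,y_k,u_k)_{k\in\mathbb N}$ contains a subsequence converging strongly in $\mathbb R^n\times Y\times U$ to a global solution of (OVR). If (OVR) has a unique global solution $(\bar\beta,\bar y,\bar u)$, then the entire sequence $(\beta_k,y_k,u_k)$ converges strongly to $(\bar\beta,\bar y,\bar u)$.
   Context: **Standing setting.** $Y,U$ are real Hilbert spaces with duals $Y^*,U^*$. $Q\subset\mathbb R^n$ is a nonempty bounded polyhedron (intersection of finitely many closed halfspaces) with nonempty interior. $U_{ad}\subset U$ is nonempty, closed, convex. $A\in L[Y,Y^*]$ is an isomorphism, $B\in L[U,Y^*]$ is bounded linear, $S:=A^{-1}B\in L[U,Y]$. The functionals $F,f:Q\times Y\times U\to\mathbb R$ are bounded from below, convex and continuously Fréchet differentiable. For every $M\ge 0$ there is $L_M\ge 0$ such that $\|f'_\beta(\beta_1,y_1,u_1)-f'_\beta(\beta_2,y_2,u_2)\|\le L_M(\|\beta_1-\beta_2\|+\|y_1-y_2\|_Y+\|u_1-u_2\|_U)$, $|F(\beta,y_1,u_1)-F(\beta,y_2,u_2)|\le L_M(\|y_1-y_2\|_Y+\|u_1-u_2\|_U)$, $\|f'_u(\beta_1,S(u),u)-f'_u(\beta_2,S(u),u)\|_{U^*}\le L_M\|\beta_1-\beta_2\|$, $\|f'_y(\beta_1,S(u),u)-f'_y(\beta_2,S(u),u)\|_{Y^*}\le L_M\|\beta_1-\beta_2\|$ for all $\beta,\beta_1,\beta_2\in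 Q$, all $y_1,y_2\in Y$ of norm $\le M$ and all $u,u_1,u_2\in U_{ad}$ of norm $\le M$. There is $\mu>0$ such that for all $\beta\in Q$, $u_1,u_2\in U_{ad}$: $f(\beta,S(u_2),u_2)\ge f(\beta,S(u_1),u_1)+\langle f'_y(\cdot),S(u_2-u_1)\rangle+\langle f'_u(\cdot),u_2-u_1\rangle+\frac\mu2\|u_2-u_1\|_U^2$, with derivatives taken at $(\beta,S(u_1),u_1)$. **Problem.** $\varphi(\beta):=\inf\{f(\beta,y,u): (y,u)\in Y\times U_{ad},\ Ay=Bu\}$ for $\beta\in Q$. Problem (OVR): minimize $F(\beta,y,u)$ subject to $\beta\in Q$, $f(\beta,y,u)\le\varphi(\beta)$, $Ay-Bu=0$, $u\in U_{ad}$. **Subdivisions.** A subdivision $\mathcal T$ of $Q$ is a finite set of non-degenerate $n$-simplices whose union is $Q$ (hanging nodes are allowed). For a simplex $T$, $\xi_T:T\to\mathbb R$ is the affine function interpolating $\varphi$ at the vertices of $T$, and the aspect ratio is $\rho(T):=\operatorname{diam}(B_T)/\operatorname{diam}(T)$, where $B_T$ is the largest ball contained in $T$. **Global Solution Algorithm.** (S1) Let $\mathcal T_1$ be a subdivision of $Q$, choose $q,\rho\in(0,1)$ with $\rho\le\min_{T\in\mathcal T_1}\rho(T)$; set $\mathcal T_0:=\emptyset$, $k:=1$. (S2) For each $T\in\mathcal T_k\setminus\mathcal T_{k-1}$ compute a global solution $(\beta_T,y_T,u_T)$ of the convex problem: minimize $F(\beta,y,u)$ subject to $\beta\in T$, $f(\beta,y,u)-\xi_T(\beta)\le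 0$, $Ay-Bu=0$, $u\in U_{ad}$ (for the other $T\in\mathcal T_k$ the previously computed solution is kept). Select $\bar T_k\in\arg\min_{T\in\mathcal T_k}F(\beta_T,y_T,u_T)$ and set $(\beta_k,y_k,u_k):=(\beta_{\bar T_k},y_{\bar T_k},u_{\bar T_k})$. (S3) If $f(\beta_k,y_k,u_k)=\varphi(\beta_k)$, stop. Otherwise construct the subdivision $\mathcal T_{k+1}$ from $\mathcal T_k$ by a refinement of $\bar T_k$ (i.e. replacing $\bar T_k$ by finitely many simplices whose union is $\bar T_k$) such that $\operatorname{vol}(T)\le q\operatorname{vol}(\bar T_k)$ and $\rho(T)\ge\rho$ for all $T\in\mathcal T_{k+1}\setminus\mathcal T_k$. Set $k:=k+1$ and go to (S2). *)

theory Defs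
  imports "HOL-Analysis.Analysis"
begin

text \<open>
  Hilbert spaces are types of sort \<open>{real_inner, complete_space}\<close>; the dual of \<open>'y\<close> is
  \<open>'y \<Rightarrow>\<^sub>L real\<close>. Functionals on \<open>Q \<times> Y \<times> U\<close> are total functions on triples \<open>(\<beta>, y, u)\<close>
  of which only the values with \<open>\<beta> \<in> Q\<close> are ever used.
\<close>

definition C1_with_derivative_on ::
  "('a::real_normed_vector \<Rightarrow> real) \<Rightarrow> ('a \<Rightarrow> 'a \<Rightarrow>\<^sub>L real) \<Rightarrow> 'a set \<Rightarrow> bool" where
  "C1_with_derivative_on g g' D \<longleftrightarrow>
     (\<forall>x\<in>D. (g has_derivative blinfun_apply (g' x)) (at x within D)) \<and> continuous_on D g'"

definition partial_beta ::
  "(('b::real_normed_vector \<times> 'y::real_normed_vector \<times> 'u::real_normed_vector) \<Rightarrow>\<^sub>L real) \<Rightarrow> ('b \<Rightarrow>\<^sub>L real)" where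
  "partial_beta D = Blinfun (\<lambda>h. blinfun_apply D (h, 0, 0))"

definition partial_y ::
  "(('b::real_normed_vector \<times> 'y::real_normed_vector \<times> 'u::real_normed_vector) \<Rightarrow>\<^sub>L real) \<Rightarrow> ('y \<Rightarrow>\<^sub>L real)" where
  "partial_y D = Blinfun (\<lambda>h. blinfun_apply D (0, h, 0))"

definition partial_u ::
  "(('b::real_normed_vector \<times> 'y::real_normed_vector \<times> 'u::real_normed_vector) \<Rightarrow>\<^sub>L real) \<Rightarrow> ('u \<Rightarrow>\<^sub>L real)" where
  "partial_u D = Blinfun (\<lambda>h. blinfun_apply D (0, 0, h))"

definition solution_op ::
  "('y::real_normed_vector \<Rightarrow>\<^sub>L ('y \<Rightarrow>\<^sub>L real)) \<Rightarrow> ('u::real_normed_vector \<Rightarrow>\<^sub>L ('y \<Rightarrow>\<^sub>L real)) \<Rightarrow> 'u \<Rightarrow> 'y" where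
  "solution_op A B u = inv (blinfun_apply A) (blinfun_apply B u)"

locale ovr_setting =
  fixes Q :: "(real^'n::finite) set"
    and Uad :: "'u::{real_inner, complete_space} set"
    and A :: "'y::{real_inner, complete_space} \<Rightarrow>\<^sub>L ('y \<Rightarrow>\<^sub>L real)"
    and B :: "'u \<Rightarrow>\<^sub>L ('y \<Rightarrow>\<^sub>L real)"
    and F :: "(real^'n) \<times> 'y \<times> 'u \<Rightarrow> real"
    and F' :: "(real^'n) \<times> 'y \<times> 'u \<Rightarrow> (((real^'n) \<times> 'y \<times> 'u) \<Rightarrow>\<^sub>L real)"
    and f :: "(real^'n) \<times> 'y \<times> 'u \<Rightarrow> real"
    and f' :: "(real^'n) \<times> 'y \<times> 'u \<Rightarrow> (((real^'n) \<times> 'y \<times> 'u) \<Rightarrow>\<^sub>L real)"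
  assumes Q_polyhedron: "polyhedron Q"
    and Q_bounded: "bounded Q"
    and Q_nonempty: "Q \<noteq> {}"
    and Q_interior: "interior Q \<noteq> {}"
    and Uad_nonempty: "Uad \<noteq> {}"
    and Uad_closed: "closed Uad"
    and Uad_convex: "convex Uad"
    and A_bij: "bij (blinfun_apply A)"
    and A_inv_bounded: "bounded_linear (inv (blinfun_apply A))"
    and F_bdd_below: "bdd_below (F ` (Q \<times> UNIV \<times> UNIV))"
    and f_bdd_below: "bdd_below (f ` (Q \<times> UNIV \<times> UNIV))"
    and F_convex: "convex_on (Q \<times> UNIV \<times> UNIV) F"
    and f_convex: "convex_on (Q \<times> UNIV \<times> UNIV) f"
    and F_C1: "C1_with_derivative_on F F' (Q \<times> UNIV \<times> UNIV)"
    and f_C1: "C1_with_derivative_on f f' (Q \<times> UNIV \<times> UNIV)"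
    and local_lipschitz:
      "\<And>M::real. 0 \<le> M \<Longrightarrow> \<exists>L\<ge>0.
         (\<forall>\<beta>1\<in>Q. \<forall>\<beta>2\<in>Q. \<forall>y1 y2. \<forall>u1\<in>Uad. \<forall>u2\<in>Uad.
            norm y1 \<le> M \<longrightarrow> norm y2 \<le> M \<longrightarrow> norm u1 \<le> M \<longrightarrow> norm u2 \<le> M \<longrightarrow>
            norm (partial_beta (f' (\<beta>1, y1, u1)) - partial_beta (f' (\<beta>2, y2, u2)))
              \<le> L * (norm (\<beta>1 - \<beta>2) + norm (y1 - y2) + norm (u1 - u2))) \<and>
         (\<forall>\<beta>\<in>Q. \<forall>y1 y2. \<forall>u1\<in>Uad. \<forall>u2\<in>Uad.
            norm y1 \<le> M \<longrightarrow> norm y2 \<le> M \<longrightarrow> norm u1 \<le> M \<longrightarrow> norm u2 \<le> M \<longrightarrow>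
            \<bar>F (\<beta>, y1, u1) - F (\<beta>, y2, u2)\<bar> \<le> L * (norm (y1 - y2) + norm (u1 - u2))) \<and>
         (\<forall>\<beta>1\<in>Q. \<forall>\<beta>2\<in>Q. \<forall>u\<in>Uad. norm u \<le> M \<longrightarrow>
            norm (partial_u (f' (\<beta>1, solution_op A B u, u)) - partial_u (f' (\<beta>2, solution_op A B u, u)))
              \<le> L * norm (\<beta>1 - \<beta>2)) \<and>
         (\<forall>\<beta>1\<in>Q. \<forall>\<beta>2\<in>Q. \<forall>u\<in>Uad. norm u \<le> M \<longrightarrow>
            norm (partial_y (f' (\<beta>1, solution_op A B u, u)) - partial_y (f' (\<beta>2, solution_op A B u, u)))
              \<le> L * norm (\<beta>1 - \<beta>2))"
    and uniform_convexity:
      "\<exists>\<mu>>0. \<forall>\<beta>\<in>Q. \<forall>u1\<in>Uad. \<forall>u2\<in>Uad.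
         f (\<beta>, solution_op A B u2, u2) \<ge> f (\<beta>, solution_op A B u1, u1)
           + blinfun_apply (partial_y (f' (\<beta>, solution_op A B u1, u1))) (solution_op A B (u2 - u1))
           + blinfun_apply (partial_u (f' (\<beta>, solution_op A B u1, u1))) (u2 - u1)
           + \<mu> / 2 * (norm (u2 - u1))\<^sup>2"

definition value_function ::
  "'u set \<Rightarrow> ('y::real_normed_vector \<Rightarrow>\<^sub>L ('y \<Rightarrow>\<^sub>L real)) \<Rightarrow> ('u::real_normed_vector \<Rightarrow>\<^sub>L ('y \<Rightarrow>\<^sub>L real)) \<Rightarrow>
   ((real^'n) \<times> 'y \<times> 'u \<Rightarrow> real) \<Rightarrow> real^'n \<Rightarrow> real" where
  "value_function Uad A B f \<beta> =
     Inf {f (\<beta>, y, u) | y u. u \<in> Uad \<and> blinfun_apply A y = blinfun_apply B u}"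

definition ovr_feasible ::
  "(real^'n) set \<Rightarrow> 'u set \<Rightarrow> ('y::real_normed_vector \<Rightarrow>\<^sub>L ('y \<Rightarrow>\<^sub>L real)) \<Rightarrow>
   ('u::real_normed_vector \<Rightarrow>\<^sub>L ('y \<Rightarrow>\<^sub>L real)) \<Rightarrow> ((real^'n) \<times> 'y \<times> 'u \<Rightarrow> real) \<Rightarrow>
   ((real^'n) \<times> 'y \<times> 'u) set" where
  "ovr_feasible Q Uad A B f =
     {(\<beta>, y, u). \<beta> \<in> Q \<and> f (\<beta>, y, u) \<le> value_function Uad A B f \<beta> \<and>
        blinfun_apply A y - blinfun_apply B u = 0 \<and> u \<in> Uad}"

definition ovr_global_solution ::
  "(real^'n) set \<Rightarrow> 'u set \<Rightarrow> ('y::real_normed_vector \<Rightarrow>\<^sub>L ('y \<Rightarrow>\<^sub>L real)) \<Rightarrow>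
   ('u::real_normed_vector \<Rightarrow>\<^sub>L ('y \<Rightarrow>\<^sub>L real)) \<Rightarrow> ((real^'n) \<times> 'y \<times> 'u \<Rightarrow> real) \<Rightarrow>
   ((real^'n) \<times> 'y \<times> 'u \<Rightarrow> real) \<Rightarrow> (real^'n) \<times> 'y \<times> 'u \<Rightarrow> bool" where
  "ovr_global_solution Q Uad A B F f = is_arg_min F (\<lambda>x. x \<in> ovr_feasible Q Uad A B f)"

text \<open>Neither disjoint interiors nor conformity is required, so hanging nodes are allowed.\<close>

definition subdivision :: "(real^'n::finite) set \<Rightarrow> (real^'n) set set \<Rightarrow> bool" where
  "subdivision P \<T> \<longleftrightarrow> finite \<T> \<and> (\<forall>T\<in>\<T>. int CARD('n) simplex T) \<and> \<Union>\<T> = P"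

text \<open>On a compact \<open>T\<close> the supremum is the diameter of a largest ball contained in \<open>T\<close>.\<close>

definition aspect_ratio :: "(real^'n::finite) set \<Rightarrow> real" where
  "aspect_ratio T = (SUP (c, r) \<in> {(c, r). cball c r \<subseteq> T}. diameter (cball c r)) / diameter T"

text \<open>For an affinely independent family of \<open>n + 1\<close> vertices exactly one affine function on
  \<open>\<real>\<^sup>n\<close> takes the prescribed values. The vertices of a simplex are its extreme points.\<close>

definition vertex_interpolant :: "(real^'n::finite \<Rightarrow> real) \<Rightarrow> (real^'n) set \<Rightarrow> real^'n \<Rightarrow> real" where
  "vertex_interpolant g T =
     (THE \<xi>. (\<exists>a c. \<xi> = (\<lambda>x. a \<bullet> x + c)) \<and> (\<forall>v. v extreme_point_of T \<longrightarrow> \<xi> v = g v))"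

definition subproblem_feasible ::
  "(real^'n::finite) set \<Rightarrow> 'u set \<Rightarrow> ('y::real_normed_vector \<Rightarrow>\<^sub>L ('y \<Rightarrow>\<^sub>L real)) \<Rightarrow>
   ('u::real_normed_vector \<Rightarrow>\<^sub>L ('y \<Rightarrow>\<^sub>L real)) \<Rightarrow> ((real^'n) \<times> 'y \<times> 'u \<Rightarrow> real) \<Rightarrow>
   ((real^'n) \<times> 'y \<times> 'u) set" where
  "subproblem_feasible T Uad A B f =
     {(\<beta>, y, u). \<beta> \<in> T \<and> f (\<beta>, y, u) - vertex_interpolant (value_function Uad A B f) T \<beta> \<le> 0 \<and>
        blinfun_apply A y - blinfun_apply B u = 0 \<and> u \<in> Uad}"

definition subproblem_global_solution ::
  "(real^'n::finite) set \<Rightarrow> 'u set \<Rightarrow> ('y::real_normed_vector \<Rightarrow>\<^sub>L ('y \<Rightarrow>\<^sub>L real)) \<Rightarrow>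
   ('u::real_normed_vector \<Rightarrow>\<^sub>L ('y \<Rightarrow>\<^sub>L real)) \<Rightarrow> ((real^'n) \<times> 'y \<times> 'u \<Rightarrow> real) \<Rightarrow>
   ((real^'n) \<times> 'y \<times> 'u \<Rightarrow> real) \<Rightarrow> (real^'n) \<times> 'y \<times> 'u \<Rightarrow> bool" where
  "subproblem_global_solution T Uad A B F f = is_arg_min F (\<lambda>x. x \<in> subproblem_feasible T Uad A B f)"

definition stop_test ::
  "'u set \<Rightarrow> ('y::real_normed_vector \<Rightarrow>\<^sub>L ('y \<Rightarrow>\<^sub>L real)) \<Rightarrow> ('u::real_normed_vector \<Rightarrow>\<^sub>L ('y \<Rightarrow>\<^sub>L real)) \<Rightarrow>
   ((real^'n) \<times> 'y \<times> 'u \<Rightarrow> real) \<Rightarrow> (real^'n) \<times> 'y \<times> 'u \<Rightarrow> bool" where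
  "stop_test Uad A B f x \<longleftrightarrow> f x = value_function Uad A B f (fst x)"

text \<open>Iteration \<open>k\<close> (counted from 1) is carried out iff no earlier iterate passed the stopping test.\<close>

definition reaches_iteration ::
  "'u set \<Rightarrow> ('y::real_normed_vector \<Rightarrow>\<^sub>L ('y \<Rightarrow>\<^sub>L real)) \<Rightarrow> ('u::real_normed_vector \<Rightarrow>\<^sub>L ('y \<Rightarrow>\<^sub>L real)) \<Rightarrow>
   ((real^'n) \<times> 'y \<times> 'u \<Rightarrow> real) \<Rightarrow> (nat \<Rightarrow> (real^'n) \<times> 'y \<times> 'u) \<Rightarrow> nat \<Rightarrow> bool" where
  "reaches_iteration Uad A B f x k \<longleftrightarrow> 1 \<le> k \<and> (\<forall>j. 1 \<le> j \<and> j < k \<longrightarrow> \<not> stop_test Uad A B f (x j))"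

definition stops_at ::
  "'u set \<Rightarrow> ('y::real_normed_vector \<Rightarrow>\<^sub>L ('y \<Rightarrow>\<^sub>L real)) \<Rightarrow> ('u::real_normed_vector \<Rightarrow>\<^sub>L ('y \<Rightarrow>\<^sub>L real)) \<Rightarrow>
   ((real^'n) \<times> 'y \<times> 'u \<Rightarrow> real) \<Rightarrow> (nat \<Rightarrow> (real^'n) \<times> 'y \<times> 'u) \<Rightarrow> nat \<Rightarrow> bool" where
  "stops_at Uad A B f x k \<longleftrightarrow> reaches_iteration Uad A B f x k \<and> stop_test Uad A B f (x k)"

text \<open>
  A run of the algorithm: \<open>\<T> k\<close> is the subdivision, \<open>sol k T\<close> the solution of the subproblem on
  \<open>T\<close> held in iteration \<open>k\<close>, \<open>Tbar k\<close> the selected simplex and \<open>x k\<close> the iterate. These sequences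
  are constrained only up to the iteration in which the algorithm stops, if it does.
  A refinement replaces the selected simplex, so the latter is not one of its own parts (\<open>refine\<close>).
\<close>

locale global_solution_algorithm =
  fixes Q :: "(real^'n::finite) set"
    and Uad :: "'u::{real_inner, complete_space} set"
    and A :: "'y::{real_inner, complete_space} \<Rightarrow>\<^sub>L ('y \<Rightarrow>\<^sub>L real)"
    and B :: "'u \<Rightarrow>\<^sub>L ('y \<Rightarrow>\<^sub>L real)"
    and F f :: "(real^'n) \<times> 'y \<times> 'u \<Rightarrow> real"
    and q \<rho> :: real
    and \<T> :: "nat \<Rightarrow> (real^'n) set set"
    and sol :: "nat \<Rightarrow> (real^'n) set \<Rightarrow> (real^'n) \<times> 'y \<times> 'u"
    and Tbar :: "nat \<Rightarrow> (real^'n) set"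
    and x :: "nat \<Rightarrow> (real^'n) \<times> 'y \<times> 'u"
  assumes init: "\<T> 0 = {}" "subdivision Q (\<T> 1)"
    and q: "0 < q" "q < 1"
    and \<rho>: "0 < \<rho>" "\<rho> < 1" "\<rho> \<le> Min (aspect_ratio ` \<T> 1)"
    and solve_new:
      "\<And>k T. reaches_iteration Uad A B f x k \<Longrightarrow> T \<in> \<T> k - \<T> (k - 1) \<Longrightarrow>
         subproblem_global_solution T Uad A B F f (sol k T)"
    and keep_old:
      "\<And>k T. reaches_iteration Uad A B f x k \<Longrightarrow> T \<in> \<T> k \<inter> \<T> (k - 1) \<Longrightarrow> sol k T = sol (k - 1) T"
    and select:
      "\<And>k. reaches_iteration Uad A B f x k \<Longrightarrow> is_arg_min (\<lambda>T. F (sol k T)) (\<lambda>T. T \<in> \<T> k) (Tbar k)"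
    and iterate:
      "\<And>k. reaches_iteration Uad A B f x k \<Longrightarrow> x k = sol k (Tbar k)"
    and refine:
      "\<And>k. reaches_iteration Uad A B f x k \<Longrightarrow> \<not> stop_test Uad A B f (x k) \<Longrightarrow>
         \<exists>R. subdivision (Tbar k) R \<and> Tbar k \<notin> R \<and> \<T> (k + 1) = (\<T> k - {Tbar k}) \<union> R"
    and refine_quality:
      "\<And>k T. reaches_iteration Uad A B f x k \<Longrightarrow> \<not> stop_test Uad A B f (x k) \<Longrightarrow> T \<in> \<T> (k + 1) - \<T> k \<Longrightarrow>
         measure lebesgue T \<le> q * measure lebesgue (Tbar k) \<and> \<rho> \<le> aspect_ratio T"

end

theory Submission
  imports Defs
begin

text \<open>
  The optimal value \<open>\<phi>\<close> of the lower level is convex in \<open>\<beta>\<close>, so on each simplex it lies below its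
  interpolant \<open>\<xi>\<^sub>T\<close> (\<open>convex_on_le_vertex_interpolant\<close>). Each subproblem is therefore a relaxation of
  the original problem restricted to \<open>T\<close>, and since the simplices cover \<open>Q\<close>, every iterate has an
  objective value not exceeding that of any feasible point (\<open>iterate_value_le\<close>). An iterate that is
  itself feasible is thus optimal, which settles the case that the algorithm stops; otherwise it
  remains to show that cluster points are feasible.

  The relaxation is controlled by the diameter: \<open>\<phi>\<close> is Lipschitz continuous, whence
  \<open>\<xi>\<^sub>T \<le> \<phi> + C diam T\<close> on \<open>T\<close>. Strong convexity of the lower level turns this gap, together with
  the distance of the parameters, into a bound for the distance of an iterate's control to the exact
  lower-level solution for a nearby parameter (\<open>relaxed_control_near_optimal\<close>). Hence, if the
  diameters of the selected simplices tend to zero, convergence of the parameters, which a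
  subsequence achieves by compactness of \<open>Q\<close>, forces strong convergence of the controls and states
  to the lower-level solution at the limit parameter.

  The diameters do tend to zero along the whole sequence. Every simplex that a refinement
  creates has at most \<open>q\<close> times the volume of the selected one, which disappears, so only finitely
  many selected simplices have a volume above any given threshold (\<open>finitely_many_large_selections\<close>), and the lower bound on the aspect ratios
  converts small volumes into small diameters. The argument applies to every subsequence of the
  iterates, so if the solution is unique, the whole sequence converges to it.
\<close>

section \<open>Affine interpolation on a simplex\<close>

text \<open>Differences to a fixed vertex are linearly independent, so a linear functional can be
  prescribed on them.\<close>

lemma affine_interpolant_exists:
  fixes C :: "'a::euclidean_space set" and g :: "'a \<Rightarrow> real"
  assumes "\<not> affine_dependent C"
  shows "\<exists>a c. \<forall>v\<in>C. a \<bullet> v + c = g v"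
proof (cases "C = {}")
  case False
  then obtain v0 where v0: "v0 \<in> C" by blast
  let ?B = "(\<lambda>v. - v0 + v) ` (C - {v0})"
  have "independent ?B"
    using assms affine_dependent_iff_dependent2[OF v0] by simp
  then obtain h where h: "linear h" "\<And>w. w \<in> ?B \<Longrightarrow> h w = g (v0 + w) - g v0"
    using linear_independent_extend[of ?B "\<lambda>w. g (v0 + w) - g v0"] by blast
  define a where "a = adjoint h 1"
  have a: "a \<bullet> w = h w" for w
    using adjoint_works[OF h(1), of w 1] by (simp add: a_def inner_commute)
  have "a \<bullet> v + (g v0 - a \<bullet> v0) = g v" if "v \<in> C" for v
  proof (cases "v = v0")
    case False
    then have "h (- v0 + v) = g v - g v0"
      using h(2)[of "- v0 + v"] that by auto
    then have "a \<bullet> (- v0 + v) = g v - g v0"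
      by (simp only: a)
    then show ?thesis
      by (simp add: inner_diff_right)
  qed simp
  then show ?thesis by blast
qed auto

text \<open>The affine hull of the \<open>n + 1\<close> vertices is the whole space, so affine functions that agree on
  them agree everywhere. With the existence of an interpolant this justifies the definite description
  behind \<open>vertex_interpolant\<close>.\<close>

lemma vertex_interpolant_affine:
  fixes T :: "(real^'n::finite) set" and g :: "real^'n \<Rightarrow> real"
  assumes "int CARD('n) simplex T"
  obtains a c where "vertex_interpolant g T = (\<lambda>x. a \<bullet> x + c)"
    and "\<And>v. v extreme_point_of T \<Longrightarrow> a \<bullet> v + c = g v"
proof -
  obtain C where C: "\<not> affine_dependent C" "int (card C) = int CARD('n) + 1" "T = convex hull C"
    using assms unfolding simplex_def by blast
  have ext: "v extreme_point_of T \<longleftrightarrow> v \<in> C" for v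
    using extreme_point_of_convex_hull_affine_independent[OF C(1)] C(3) by blast
  have "aff_dim C = int DIM(real^'n)"
    using aff_dim_affine_independent[OF C(1)] C(2) by simp
  then have hull: "affine hull C = UNIV"
    using aff_dim_eq_full by blast
  obtain a c where ac: "\<forall>v\<in>C. a \<bullet> v + c = g v"
    using affine_interpolant_exists[OF C(1)] by blast
  have "vertex_interpolant g T = (\<lambda>x. a \<bullet> x + c)"
    unfolding vertex_interpolant_def
  proof (rule the_equality)
    show "(\<exists>a' c'. (\<lambda>x. a \<bullet> x + c) = (\<lambda>x. a' \<bullet> x + c')) \<and> (\<forall>v. v extreme_point_of T \<longrightarrow> a \<bullet> v + c = g v)"
      using ac ext by blast
  next
    fix \<xi> assume \<xi>: "(\<exists>a c. \<xi> = (\<lambda>x. a \<bullet> x + c)) \<and> (\<forall>v. v extreme_point_of T \<longrightarrow> \<xi> v = g v)"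
    then obtain a' c' where \<xi>_eq: "\<xi> = (\<lambda>x. a' \<bullet> x + c')" by blast
    have "C \<subseteq> {x. (a' - a) \<bullet> x = c - c'}"
    proof
      fix v assume "v \<in> C"
      then have "\<xi> v = a \<bullet> v + c"
        using ac ext \<xi> by simp
      then show "v \<in> {x. (a' - a) \<bullet> x = c - c'}"
        by (simp add: \<xi>_eq inner_diff_left)
    qed
    then have "affine hull C \<subseteq> {x. (a' - a) \<bullet> x = c - c'}"
      by (simp add: hull_minimal affine_hyperplane)
    then have "(a' - a) \<bullet> x = c - c'" for x
      using hull by blast
    then show "\<xi> = (\<lambda>x. a \<bullet> x + c)"
      by (auto simp: \<xi>_eq inner_diff_left algebra_simps)
  qed
  then show ?thesis using that ac ext by blast
qed

text \<open>Affine functions commute with convex combinations. This reduces bounds for the interpolant to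
  bounds for the values at the vertices.\<close>

lemma vertex_interpolant_barycentric:
  fixes T :: "(real^'n::finite) set" and g :: "real^'n \<Rightarrow> real"
  assumes "int CARD('n) simplex T" and "\<beta> \<in> T"
  shows "\<exists>C w. finite C \<and> C \<noteq> {} \<and> C \<subseteq> T \<and> (\<forall>v\<in>C. 0 \<le> w v) \<and> sum w C = 1 \<and>
    (\<Sum>v\<in>C. w v *\<^sub>R v) = \<beta> \<and> vertex_interpolant g T \<beta> = (\<Sum>v\<in>C. w v * g v)"
proof -
  obtain a c where ac: "vertex_interpolant g T = (\<lambda>x. a \<bullet> x + c)"
    "\<And>v. v extreme_point_of T \<Longrightarrow> a \<bullet> v + c = g v"
    using vertex_interpolant_affine[OF assms(1)] by blast
  obtain C where C: "finite C" "\<not> affine_dependent C" "T = convex hull C"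
    using assms(1) unfolding simplex by blast
  obtain w where w: "\<forall>v\<in>C. 0 \<le> w v" "sum w C = 1" "(\<Sum>v\<in>C. w v *\<^sub>R v) = \<beta>"
    using assms(2) C convex_hull_finite[OF C(1)] by auto
  have "a \<bullet> \<beta> + c = (\<Sum>v\<in>C. w v * (a \<bullet> v)) + (\<Sum>v\<in>C. w v * c)"
    using w(2) by (simp add: w(3)[symmetric] inner_sum_right sum_distrib_right[symmetric])
  also have "\<dots> = (\<Sum>v\<in>C. w v * (a \<bullet> v + c))"
    by (simp add: sum.distrib distrib_left)
  also have "\<dots> = (\<Sum>v\<in>C. w v * g v)"
    using ac(2) C extreme_point_of_convex_hull_affine_independent[OF C(2)]
    by (intro sum.cong) auto
  finally have "vertex_interpolant g T \<beta> = (\<Sum>v\<in>C. w v * g v)"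
    by (simp add: ac(1))
  moreover have "C \<noteq> {}" using w(2) by auto
  moreover have "C \<subseteq> T" unfolding C(3) by (rule hull_subset)
  ultimately show ?thesis
    using C(1) w by (intro exI[of _ C] exI[of _ w] conjI)
qed

lemma convex_on_le_vertex_interpolant:
  fixes T :: "(real^'n::finite) set" and g :: "real^'n \<Rightarrow> real"
  assumes "int CARD('n) simplex T" "T \<subseteq> D" "convex_on D g" "\<beta> \<in> T"
  shows "g \<beta> \<le> vertex_interpolant g T \<beta>"
proof -
  obtain C w where C: "finite C" "C \<noteq> {}" "C \<subseteq> T" "\<forall>v\<in>C. 0 \<le> w v" "sum w C = 1"
    "(\<Sum>v\<in>C. w v *\<^sub>R v) = \<beta>" "vertex_interpolant g T \<beta> = (\<Sum>v\<in>C. w v * g v)"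
    using vertex_interpolant_barycentric[OF assms(1,4), of g] by blast
  have "g (\<Sum>v\<in>C. w v *\<^sub>R v) \<le> (\<Sum>v\<in>C. w v * g v)"
    using C assms(2) by (intro convex_on_sum[OF _ _ assms(3)]) auto
  then show ?thesis using C by simp
qed

lemma vertex_interpolant_le:
  fixes T :: "(real^'n::finite) set" and g :: "real^'n \<Rightarrow> real"
  assumes "int CARD('n) simplex T" "\<beta> \<in> T" "\<And>v. v \<in> T \<Longrightarrow> g v \<le> K"
  shows "vertex_interpolant g T \<beta> \<le> K"
proof -
  obtain C w where C: "finite C" "C \<noteq> {}" "C \<subseteq> T" "\<forall>v\<in>C. 0 \<le> w v" "sum w C = 1"
    "(\<Sum>v\<in>C. w v *\<^sub>R v) = \<beta>" "vertex_interpolant g T \<beta> = (\<Sum>v\<in>C. w v * g v)"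
    using vertex_interpolant_barycentric[OF assms(1,2), of g] by blast
  have "(\<Sum>v\<in>C. w v * g v) \<le> (\<Sum>v\<in>C. w v * K)"
    using C assms by (intro sum_mono mult_left_mono) auto
  then show ?thesis using C by (simp add: sum_distrib_right[symmetric])
qed

lemma vertex_interpolant_le_lipschitz:
  fixes T :: "(real^'n::finite) set" and g :: "real^'n \<Rightarrow> real"
  assumes T: "int CARD('n) simplex T" "\<beta> \<in> T"
    and lip: "\<And>v. v \<in> T \<Longrightarrow> g v \<le> g \<beta> + C * norm (v - \<beta>)" and "0 \<le> C"
  shows "vertex_interpolant g T \<beta> \<le> g \<beta> + C * diameter T"
proof (rule vertex_interpolant_le[OF T])
  fix v assume v: "v \<in> T"
  have "norm (v - \<beta>) \<le> diameter T"
    using diameter_bounded_bound[OF compact_imp_bounded[OF compact_simplex[OF T(1)]] v T(2)]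
    by (simp add: dist_norm)
  then show "g v \<le> g \<beta> + C * diameter T"
    using lip[OF v] mult_left_mono[OF _ \<open>0 \<le> C\<close>] by fastforce
qed

section \<open>Volumes and diameters\<close>

text \<open>An aspect ratio of at least \<open>\<rho>\<close> provides an inscribed ball whose radius is comparable to the
  diameter, so a small volume forces a small diameter. The factor 4 instead of 2 leaves room for
  taking a ball whose diameter only comes close to the supremum.\<close>

lemma diameter_power_le_measure:
  fixes T :: "(real^'n::finite) set"
  assumes "compact T" "0 < \<rho>" "\<rho> \<le> aspect_ratio T"
  shows "(\<rho> / 4 * diameter T) ^ CARD('n) * unit_ball_vol CARD('n) \<le> measure lebesgue T"
proof (cases "diameter T = 0")
  case False
  then have d: "0 < diameter T"
    using diameter_ge_0[OF compact_imp_bounded[OF assms(1)]] by simp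
  let ?X = "(\<lambda>(c, r). diameter (cball c r)) ` {(c, r). cball c r \<subseteq> T}"
  have "\<rho> * diameter T \<le> Sup ?X"
    using assms(3) d by (simp add: aspect_ratio_def pos_le_divide_eq)
  moreover have "\<rho> / 2 * diameter T < \<rho> * diameter T"
    using d assms(2) by simp
  ultimately have less: "\<rho> / 2 * diameter T < Sup ?X" by linarith
  \<comment> \<open>Balls of negative radius are empty, so there is always an admissible pair.\<close>
  have "(0, -1) \<in> {(c :: real^'n, r). cball c r \<subseteq> T}" by simp
  then have "?X \<noteq> {}" by blast
  from less_cSupD[OF this less] obtain c r where cr: "cball c r \<subseteq> T"
    "\<rho> / 2 * diameter T < diameter (cball c r)" by auto
  have pos: "0 < \<rho> / 2 * diameter T"
    using d assms(2) by simp
  have r: "0 \<le> r" "\<rho> / 4 * diameter T \<le> r"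
    using cr(2) pos by (auto simp: diameter_cball split: if_splits)
  have "(\<rho> / 4 * diameter T) ^ CARD('n) * unit_ball_vol CARD('n) \<le> r ^ CARD('n) * unit_ball_vol CARD('n)"
    using r pos by (intro mult_right_mono power_mono) auto
  also have "\<dots> = measure lebesgue (cball c r)"
    using content_cball[OF r(1), of c] by (simp add: mult.commute)
  also have "\<dots> \<le> measure lebesgue T"
    using cr(1) assms(1) by (intro measure_mono_fmeasurable) (auto simp: lmeasurable_compact)
  finally show ?thesis .
qed (simp add: power_0_left)

lemma diameter_tendsto_0:
  fixes T :: "nat \<Rightarrow> (real^'n::finite) set"
  assumes comp: "\<And>k. compact (T k)" and \<rho>: "0 < \<rho>" "\<And>k. \<rho> \<le> aspect_ratio (T k)"
    and vol: "(\<lambda>k. measure lebesgue (T k)) \<longlonglongrightarrow> 0"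
  shows "(\<lambda>k. diameter (T k)) \<longlonglongrightarrow> 0"
proof -
  let ?n = "CARD('n)"
  let ?b = "\<lambda>k. 4 / \<rho> * root ?n (measure lebesgue (T k) / unit_ball_vol ?n)"
  have n: "0 < ?n" by simp
  have \<omega>: "0 < unit_ball_vol ?n" by simp
  have bound: "diameter (T k) \<le> ?b k" for k
  proof -
    have nonneg: "0 \<le> \<rho> / 4 * diameter (T k)"
      using \<rho>(1) diameter_ge_0[OF compact_imp_bounded[OF comp]] by simp
    have "(\<rho> / 4 * diameter (T k)) ^ ?n \<le> measure lebesgue (T k) / unit_ball_vol ?n"
      using diameter_power_le_measure[OF comp \<rho>(1) \<rho>(2)] \<omega> by (simp add: pos_le_divide_eq)
    then have "\<rho> / 4 * diameter (T k) \<le> root ?n (measure lebesgue (T k) / unit_ball_vol ?n)"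
      using real_root_le_mono[OF n, of "(\<rho> / 4 * diameter (T k)) ^ ?n"]
      by (simp only: real_root_power_cancel[OF n nonneg])
    then show ?thesis using \<rho>(1) by (simp add: field_simps)
  qed
  have "?b \<longlonglongrightarrow> 4 / \<rho> * root ?n (0 / unit_ball_vol ?n)"
    using vol less_imp_neq[OF \<omega>] by (intro tendsto_intros) auto
  then have "?b \<longlonglongrightarrow> 0" by simp
  then show ?thesis
    using bound diameter_ge_0[OF compact_imp_bounded[OF comp]]
    by (intro tendsto_sandwich[OF _ _ tendsto_const \<open>?b \<longlonglongrightarrow> 0\<close>] always_eventually) auto
qed

text \<open>Each chosen element is dropped for good, so no element is chosen twice; all of them lie in
  the first of the decreasing sets.\<close>

lemma finite_drops:
  fixes L :: "nat \<Rightarrow> 'a set" and t :: "nat \<Rightarrow> 'a"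
  assumes fin: "finite (L K)" and drop: "\<And>k. K \<le> k \<Longrightarrow> L (Suc k) \<subseteq> L k - {t k}"
  shows "finite {k. K \<le> k \<and> t k \<in> L k}"
proof -
  have decr: "L k \<subseteq> L j" if "K \<le> j" "j \<le> k" for j k
    using that(2)
  proof (induction rule: dec_induct)
    case (step l)
    then show ?case using drop[of l] that(1) by auto
  qed simp
  have ne: "t k \<noteq> t j" if "K \<le> j" "j < k" "t k \<in> L k" for j k
    using decr[of "Suc j" k] drop[of j] that by auto
  have inj: "inj_on t {k. K \<le> k \<and> t k \<in> L k}"
  proof (rule inj_onI)
    fix i j assume "i \<in> {k. K \<le> k \<and> t k \<in> L k}" "j \<in> {k. K \<le> k \<and> t k \<in> L k}" "t i = t j"
    then show "i = j"
      using ne[of i j] ne[of j i] by (cases i j rule: linorder_cases) auto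
  qed
  have "t ` {k. K \<le> k \<and> t k \<in> L k} \<subseteq> L K"
    using decr by blast
  then show ?thesis
    using finite_imageD[OF finite_subset[OF _ fin] inj] by simp
qed

section \<open>The lower-level problem\<close>

lemma continuous_on_of_C1: "C1_with_derivative_on g g' D \<Longrightarrow> continuous_on D g"
  unfolding C1_with_derivative_on_def
  by (rule has_derivative_continuous_on[where f' = "\<lambda>x. blinfun_apply (g' x)"]) simp

context ovr_setting
begin

abbreviation "S \<equiv> solution_op A B"
abbreviation "\<phi> \<equiv> value_function Uad A B f"

lemma bounded_linear_S: "bounded_linear S"
proof -
  have "S = (\<lambda>u. inv (blinfun_apply A) (blinfun_apply B u))"
    by (auto simp: solution_op_def)
  then show ?thesis
    using bounded_linear_compose[OF A_inv_bounded blinfun.bounded_linear_right] by simp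
qed

lemma state_equation_iff: "blinfun_apply A y = blinfun_apply B u \<longleftrightarrow> y = S u"
  unfolding solution_op_def using A_bij by (metis bij_inv_eq_iff)

lemma convex_Q: "convex Q"
  by (simp add: Q_polyhedron polyhedron_imp_convex)

lemma compact_Q: "compact Q"
  by (simp add: Q_polyhedron Q_bounded compact_eq_bounded_closed polyhedron_imp_closed)

lemma value_function_eq_INF: "\<phi> \<beta> = (INF u\<in>Uad. f (\<beta>, S u, u))"
proof -
  have "{f (\<beta>, y, u) | y u. u \<in> Uad \<and> blinfun_apply A y = blinfun_apply B u} = (\<lambda>u. f (\<beta>, S u, u)) ` Uad"
    unfolding state_equation_iff by blast
  then show ?thesis by (simp add: value_function_def)
qed

lemma bdd_below_reduced: "\<beta> \<in> Q \<Longrightarrow> bdd_below ((\<lambda>u. f (\<beta>, S u, u)) ` Uad)"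
  by (rule bdd_below_mono[OF f_bdd_below]) auto

lemma value_function_le: "\<beta> \<in> Q \<Longrightarrow> u \<in> Uad \<Longrightarrow> \<phi> \<beta> \<le> f (\<beta>, S u, u)"
  unfolding value_function_eq_INF by (rule cINF_lower[OF bdd_below_reduced])

text \<open>Add the strong convexity inequalities from the midpoint to both ends: the terms with the
  derivative cancel, and the value at the midpoint is at least \<open>\<phi> \<beta>\<close>. Hence controls that are
  almost optimal for the same parameter are close to each other.\<close>

lemma midpoint_strong_convexity:
  obtains \<mu> where "0 < \<mu>"
    "\<And>\<beta> u1 u2. \<beta> \<in> Q \<Longrightarrow> u1 \<in> Uad \<Longrightarrow> u2 \<in> Uad \<Longrightarrow>
       \<mu> * (norm (u1 - u2))\<^sup>2 \<le> f (\<beta>, S u1, u1) + f (\<beta>, S u2, u2) - 2 * \<phi> \<beta>"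
proof -
  obtain \<mu> where \<mu>: "\<mu> > 0" and uc: "\<And>\<beta> u1 u2. \<beta> \<in> Q \<Longrightarrow> u1 \<in> Uad \<Longrightarrow> u2 \<in> Uad \<Longrightarrow>
         f (\<beta>, S u2, u2) \<ge> f (\<beta>, S u1, u1)
           + blinfun_apply (partial_y (f' (\<beta>, S u1, u1))) (S (u2 - u1))
           + blinfun_apply (partial_u (f' (\<beta>, S u1, u1))) (u2 - u1)
           + \<mu> / 2 * (norm (u2 - u1))\<^sup>2"
    using uniform_convexity by metis
  have "\<mu> / 4 * (norm (u1 - u2))\<^sup>2 \<le> f (\<beta>, S u1, u1) + f (\<beta>, S u2, u2) - 2 * \<phi> \<beta>"
    if "\<beta> \<in> Q" "u1 \<in> Uad" "u2 \<in> Uad" for \<beta> u1 u2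
  proof -
    define m where "m = (1/2) *\<^sub>R u1 + (1/2) *\<^sub>R u2"
    define d where "d = (1/2) *\<^sub>R (u1 - u2)"
    have m: "m \<in> Uad"
      using convexD[OF Uad_convex that(2,3), of "1/2" "1/2"] by (simp add: m_def)
    have "u1 = m + d" "u2 = m - d"
      by (simp_all add: m_def d_def algebra_simps flip: scaleR_add_left)
    then have d: "u1 - m = d" "u2 - m = - d" by simp_all
    have "S (- d) = - S d"
      using bounded_linear_S by (simp add: bounded_linear.linear linear_neg)
    then have "f (\<beta>, S u1, u1) + f (\<beta>, S u2, u2) \<ge> 2 * f (\<beta>, S m, m) + \<mu> * (norm d)\<^sup>2"
      using uc[OF that(1) m that(2)] uc[OF that(1) m that(3)] unfolding d
      by (simp add: blinfun.minus_right)
    moreover have "(norm d)\<^sup>2 = (norm (u1 - u2))\<^sup>2 / 4"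
      by (simp add: d_def power_divide)
    ultimately show ?thesis
      using value_function_le[OF that(1) m] by simp
  qed
  then show ?thesis using that[of "\<mu> / 4"] \<mu> by simp
qed

lemma continuous_on_objectives: "continuous_on (Q \<times> UNIV \<times> UNIV) F" "continuous_on (Q \<times> UNIV \<times> UNIV) f"
  using F_C1 f_C1 by (auto intro: continuous_on_of_C1)

lemma continuous_on_reduced_control: "\<beta> \<in> Q \<Longrightarrow> continuous_on Uad (\<lambda>u. f (\<beta>, S u, u))"
  by (rule continuous_on_compose2[OF continuous_on_objectives(2)])
    (auto intro!: continuous_intros bounded_linear.continuous_on[OF bounded_linear_S])

lemma continuous_on_reduced_parameter: "continuous_on Q (\<lambda>\<beta>. f (\<beta>, y, u))"
  by (rule continuous_on_compose2[OF continuous_on_objectives(2)]) (auto intro!: continuous_intros)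

text \<open>The direct method: by the midpoint inequality every minimizing sequence is a Cauchy
  sequence, so it converges strongly.\<close>

lemma value_function_attained:
  assumes \<beta>: "\<beta> \<in> Q"
  obtains u where "u \<in> Uad" "f (\<beta>, S u, u) = \<phi> \<beta>"
proof -
  obtain \<mu> where \<mu>: "0 < \<mu>" "\<And>\<beta> u1 u2. \<beta> \<in> Q \<Longrightarrow> u1 \<in> Uad \<Longrightarrow> u2 \<in> Uad \<Longrightarrow>
       \<mu> * (norm (u1 - u2))\<^sup>2 \<le> f (\<beta>, S u1, u1) + f (\<beta>, S u2, u2) - 2 * \<phi> \<beta>"
    using midpoint_strong_convexity by blast
  have "\<exists>u\<in>Uad. f (\<beta>, S u, u) < \<phi> \<beta> + inverse (real (Suc n))" for n
    using cINF_less_iff[OF Uad_nonempty bdd_below_reduced[OF \<beta>], of "\<phi> \<beta> + inverse (real (Suc n))"]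
    unfolding value_function_eq_INF by simp
  then obtain w where w: "\<And>n. w n \<in> Uad" "\<And>n. f (\<beta>, S (w n), w n) < \<phi> \<beta> + inverse (real (Suc n))"
    by metis
  have "Cauchy w"
  proof (rule metric_CauchyI)
    fix e :: real assume e: "0 < e"
    then have "0 < \<mu> * e\<^sup>2 / 2" using \<mu>(1) by simp
    then obtain N where N: "inverse (real (Suc N)) < \<mu> * e\<^sup>2 / 2"
      using reals_Archimedean by blast
    have "dist (w i) (w j) < e" if "N \<le> i" "N \<le> j" for i j
    proof -
      have small: "inverse (real (Suc l)) \<le> inverse (real (Suc N))" if "N \<le> l" for l
        using that by (simp add: field_simps)
      have "\<mu> * (norm (w i - w j))\<^sup>2 < \<mu> * e\<^sup>2"
        using \<mu>(2)[OF \<beta> w(1) w(1), of i j] w(2)[of i] w(2)[of j] small[OF that(1)] small[OF that(2)] N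
        by linarith
      then have "(norm (w i - w j))\<^sup>2 < e\<^sup>2" using \<mu>(1) by simp
      then show ?thesis using e by (simp add: dist_norm power2_less_imp_less)
    qed
    then show "\<exists>N. \<forall>i\<ge>N. \<forall>j\<ge>N. dist (w i) (w j) < e" by blast
  qed
  then obtain u where u: "w \<longlonglongrightarrow> u"
    using Cauchy_convergent_iff convergent_def by blast
  have uU: "u \<in> Uad"
    using closed_sequentially[OF Uad_closed] w(1) u by blast
  have "(\<lambda>n. f (\<beta>, S (w n), w n)) \<longlonglongrightarrow> f (\<beta>, S u, u)"
    using continuous_on_reduced_control[OF \<beta>] u uU w(1)
    by (auto simp: continuous_on_sequentially o_def)
  moreover have "(\<lambda>n. \<phi> \<beta> + inverse (real (Suc n))) \<longlonglongrightarrow> \<phi> \<beta> + 0"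
    by (intro tendsto_intros LIMSEQ_inverse_real_of_nat)
  ultimately have "f (\<beta>, S u, u) \<le> \<phi> \<beta> + 0"
    by (rule LIMSEQ_le) (use w(2) less_imp_le in blast)
  then show ?thesis
    using that[OF uU] value_function_le[OF \<beta> uU] by linarith
qed

text \<open>The constraints are convex and do not involve \<open>\<beta>\<close>, so a convex combination of optimal controls is
  admissible at the corresponding combination of the parameters.\<close>

lemma convex_on_value_function: "convex_on Q \<phi>"
proof (rule convex_onI[OF _ convex_Q])
  fix t :: real and \<beta>1 \<beta>2 assume t: "0 < t" "t < 1" and \<beta>: "\<beta>1 \<in> Q" "\<beta>2 \<in> Q"
  obtain u1 where u1: "u1 \<in> Uad" "f (\<beta>1, S u1, u1) = \<phi> \<beta>1"
    using value_function_attained[OF \<beta>(1)] by blast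
  obtain u2 where u2: "u2 \<in> Uad" "f (\<beta>2, S u2, u2) = \<phi> \<beta>2"
    using value_function_attained[OF \<beta>(2)] by blast
  let ?\<beta> = "(1 - t) *\<^sub>R \<beta>1 + t *\<^sub>R \<beta>2"
  let ?u = "(1 - t) *\<^sub>R u1 + t *\<^sub>R u2"
  have S: "S ?u = (1 - t) *\<^sub>R S u1 + t *\<^sub>R S u2"
    using bounded_linear_S by (simp add: bounded_linear.linear linear_add linear_cmul)
  have "?\<beta> \<in> Q" "?u \<in> Uad"
    using t \<beta> u1(1) u2(1) by (auto intro!: convexD[OF convex_Q] convexD[OF Uad_convex])
  then have "\<phi> ?\<beta> \<le> f (?\<beta>, S ?u, ?u)" by (rule value_function_le)
  also have "\<dots> = f ((1 - t) *\<^sub>R (\<beta>1, S u1, u1) + t *\<^sub>R (\<beta>2, S u2, u2))"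
    by (simp add: S)
  also have "\<dots> \<le> (1 - t) * f (\<beta>1, S u1, u1) + t * f (\<beta>2, S u2, u2)"
    using t \<beta> by (intro convex_onD[OF f_convex]) auto
  finally show "\<phi> ?\<beta> \<le> (1 - t) * \<phi> \<beta>1 + t * \<phi> \<beta>2"
    by (simp add: u1(2) u2(2))
qed

lemma reduced_bounded_in_parameter:
  assumes "u \<in> Uad"
  obtains K where "\<And>\<beta>. \<beta> \<in> Q \<Longrightarrow> f (\<beta>, S u, u) \<le> K"
proof -
  have "bounded ((\<lambda>\<beta>. f (\<beta>, S u, u)) ` Q)"
    using compact_continuous_image[OF continuous_on_reduced_parameter compact_Q]
    by (rule compact_imp_bounded)
  then obtain K where "\<forall>r\<in>(\<lambda>\<beta>. f (\<beta>, S u, u)) ` Q. r \<le> K"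
    using bounded_imp_bdd_above unfolding bdd_above_def by blast
  then show ?thesis using that by blast
qed

lemma value_function_bounded_above:
  obtains K where "\<And>\<beta>. \<beta> \<in> Q \<Longrightarrow> \<phi> \<beta> \<le> K"
proof -
  obtain u where u: "u \<in> Uad" using Uad_nonempty by blast
  obtain K where K: "\<And>\<beta>. \<beta> \<in> Q \<Longrightarrow> f (\<beta>, S u, u) \<le> K"
    using reduced_bounded_in_parameter[OF u] by blast
  have "\<phi> \<beta> \<le> K" if "\<beta> \<in> Q" for \<beta>
    using value_function_le[OF that u] K[OF that] by linarith
  then show ?thesis using that by blast
qed

text \<open>Comparing with one fixed control by strong convexity gives a bound that is uniform in \<open>\<beta>\<close>,
  because \<open>f\<close> is bounded from below and the fixed control has bounded values on the compact \<open>Q\<close>.\<close>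

lemma sublevel_controls_bounded:
  obtains M where "\<And>\<beta> u. \<beta> \<in> Q \<Longrightarrow> u \<in> Uad \<Longrightarrow> f (\<beta>, S u, u) \<le> K \<Longrightarrow> norm u \<le> M"
proof -
  obtain \<mu> where \<mu>: "0 < \<mu>" "\<And>\<beta> u1 u2. \<beta> \<in> Q \<Longrightarrow> u1 \<in> Uad \<Longrightarrow> u2 \<in> Uad \<Longrightarrow>
       \<mu> * (norm (u1 - u2))\<^sup>2 \<le> f (\<beta>, S u1, u1) + f (\<beta>, S u2, u2) - 2 * \<phi> \<beta>"
    using midpoint_strong_convexity by blast
  obtain u0 where u0: "u0 \<in> Uad" using Uad_nonempty by blast
  obtain K0 where K0: "\<And>\<beta>. \<beta> \<in> Q \<Longrightarrow> f (\<beta>, S u0, u0) \<le> K0"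
    using reduced_bounded_in_parameter[OF u0] by blast
  obtain m where m: "\<And>z. z \<in> Q \<times> UNIV \<times> UNIV \<Longrightarrow> m \<le> f z"
    using f_bdd_below by (auto simp: bdd_below_def)
  have "norm u \<le> sqrt ((K + K0 - 2 * m) / \<mu>) + norm u0"
    if h: "\<beta> \<in> Q" "u \<in> Uad" "f (\<beta>, S u, u) \<le> K" for \<beta> u
  proof -
    obtain v where "f (\<beta>, S v, v) = \<phi> \<beta>"
      using value_function_attained[OF h(1)] by blast
    then have "m \<le> \<phi> \<beta>"
      using m[of "(\<beta>, S v, v)"] h(1) by simp
    then have "\<mu> * (norm (u - u0))\<^sup>2 \<le> K + K0 - 2 * m"
      using \<mu>(2)[OF h(1,2) u0] h(3) K0[OF h(1)] by linarith
    then have "(norm (u - u0))\<^sup>2 \<le> (K + K0 - 2 * m) / \<mu>"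
      using \<mu>(1) by (simp add: field_simps)
    then have "norm (u - u0) \<le> sqrt ((K + K0 - 2 * m) / \<mu>)"
      by (rule real_le_rsqrt)
    then show ?thesis using norm_triangle_sub[of u u0] by linarith
  qed
  then show ?thesis using that by blast
qed

text \<open>The mean value inequality in \<open>\<beta>\<close>: the local Lipschitz condition on the partial derivative
  with respect to \<open>\<beta>\<close> bounds this derivative on bounded sets.\<close>

lemma reduced_lipschitz_in_parameter:
  obtains C where "0 \<le> C"
    "\<And>\<beta>1 \<beta>2 u. \<beta>1 \<in> Q \<Longrightarrow> \<beta>2 \<in> Q \<Longrightarrow> u \<in> Uad \<Longrightarrow> norm u \<le> M \<Longrightarrow>
       \<bar>f (\<beta>1, S u, u) - f (\<beta>2, S u, u)\<bar> \<le> C * norm (\<beta>1 - \<beta>2)"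
proof -
  obtain u0 where u0: "u0 \<in> Uad" using Uad_nonempty by blast
  obtain \<beta>0 where \<beta>0: "\<beta>0 \<in> Q" using Q_nonempty by blast
  obtain s where s: "0 < s" "\<And>u. norm (S u) \<le> norm u * s"
    using bounded_linear.pos_bounded[OF bounded_linear_S] by blast
  obtain b where b: "\<And>\<beta>. \<beta> \<in> Q \<Longrightarrow> norm \<beta> \<le> b"
    using Q_bounded bounded_iff by blast
  define M1 where "M1 = max \<bar>M\<bar> (norm u0)"
  define M2 where "M2 = M1 * s + M1"
  have M1: "0 \<le> M1" "\<bar>M\<bar> \<le> M1" "norm u0 \<le> M1" by (auto simp: M1_def)
  have M2: "norm (S u) \<le> M2" "norm u \<le> M2" if "norm u \<le> M1" for u
  proof -
    have "norm u * s \<le> M1 * s" using that s(1) by (intro mult_right_mono) auto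
    moreover have "0 \<le> M1 * s" using M1(1) s(1) by simp
    ultimately show "norm (S u) \<le> M2" "norm u \<le> M2"
      using s(2)[of u] that M1(1) by (auto simp: M2_def)
  qed
  have "0 \<le> M2" using M2(1)[OF M1(3)] norm_ge_zero[of "S u0"] by linarith
  obtain L where L: "0 \<le> L" and lip:
      "\<forall>\<beta>1\<in>Q. \<forall>\<beta>2\<in>Q. \<forall>y1 y2. \<forall>u1\<in>Uad. \<forall>u2\<in>Uad.
            norm y1 \<le> M2 \<longrightarrow> norm y2 \<le> M2 \<longrightarrow> norm u1 \<le> M2 \<longrightarrow> norm u2 \<le> M2 \<longrightarrow>
            norm (partial_beta (f' (\<beta>1, y1, u1)) - partial_beta (f' (\<beta>2, y2, u2)))
              \<le> L * (norm (\<beta>1 - \<beta>2) + norm (y1 - y2) + norm (u1 - u2))"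
    using local_lipschitz[OF \<open>0 \<le> M2\<close>] by (elim exE conjE) (rule that)
  define C where "C = norm (partial_beta (f' (\<beta>0, S u0, u0))) + L * (2 * b + 2 * M2 + 2 * M2)"
  have b0: "0 \<le> b" using b[OF \<beta>0] norm_ge_zero order_trans by blast
  have C: "norm (partial_beta (f' (\<beta>, S u, u))) \<le> C" if "\<beta> \<in> Q" "u \<in> Uad" "norm u \<le> M1" for \<beta> u
  proof -
    have "norm (\<beta> - \<beta>0) \<le> 2 * b" "norm (S u - S u0) \<le> 2 * M2" "norm (u - u0) \<le> 2 * M2"
      using norm_triangle_ineq4[of \<beta> \<beta>0] norm_triangle_ineq4[of "S u" "S u0"]
        norm_triangle_ineq4[of u u0] b[OF that(1)] b[OF \<beta>0] M2[OF that(3)] M2[OF M1(3)] by linarith+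
    then have "norm (\<beta> - \<beta>0) + norm (S u - S u0) + norm (u - u0) \<le> 2 * b + 2 * M2 + 2 * M2"
      by linarith
    then have "L * (norm (\<beta> - \<beta>0) + norm (S u - S u0) + norm (u - u0)) \<le> L * (2 * b + 2 * M2 + 2 * M2)"
      using L by (rule mult_left_mono)
    then have "norm (partial_beta (f' (\<beta>, S u, u)) - partial_beta (f' (\<beta>0, S u0, u0)))
        \<le> L * (2 * b + 2 * M2 + 2 * M2)"
      using lip that(1,2) \<beta>0 u0 M2[OF that(3)] M2[OF M1(3)] order_trans by blast
    then show ?thesis
      unfolding C_def
      using norm_triangle_sub[of "partial_beta (f' (\<beta>, S u, u))" "partial_beta (f' (\<beta>0, S u0, u0))"]
      by linarith
  qed
  have partial: "blinfun_apply (partial_beta D) h = blinfun_apply D (h, 0, 0)"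
    for D :: "((real^'n) \<times> 'y \<times> 'u) \<Rightarrow>\<^sub>L real" and h
  proof -
    have "bounded_linear (\<lambda>h::real^'n. blinfun_apply D (h, 0, 0))"
      by (intro bounded_linear_compose[OF blinfun.bounded_linear_right] bounded_linear_Pair
          bounded_linear_ident bounded_linear_zero)
    then show ?thesis by (simp add: partial_beta_def bounded_linear_Blinfun_apply)
  qed
  have "\<bar>f (\<beta>1, S u, u) - f (\<beta>2, S u, u)\<bar> \<le> C * norm (\<beta>1 - \<beta>2)"
    if \<beta>: "\<beta>1 \<in> Q" "\<beta>2 \<in> Q" and u: "u \<in> Uad" "norm u \<le> M" for \<beta>1 \<beta>2 u
  proof -
    have "norm (f (\<beta>1, S u, u) - f (\<beta>2, S u, u)) \<le> C * norm (\<beta>1 - \<beta>2)"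
    proof (rule differentiable_bound[OF convex_Q, where f' = "\<lambda>\<beta>. blinfun_apply (partial_beta (f' (\<beta>, S u, u)))"])
      fix \<beta> assume \<beta>Q: "\<beta> \<in> Q"
      have D: "(f has_derivative blinfun_apply (f' z)) (at z within Q \<times> UNIV \<times> UNIV)" if "z \<in> Q \<times> UNIV \<times> UNIV" for z
        using f_C1 that unfolding C1_with_derivative_on_def by blast
      have "((\<lambda>\<beta>. (\<beta>, S u, u)) has_derivative (\<lambda>h. (h, 0, 0))) (at \<beta> within Q)"
        by (auto intro!: derivative_eq_intros simp: zero_prod_def)
      from has_derivative_in_compose2[OF D _ \<beta>Q this]
      have "((\<lambda>\<beta>. f (\<beta>, S u, u)) has_derivative (\<lambda>h. blinfun_apply (f' (\<beta>, S u, u)) (h, 0, 0))) (at \<beta> within Q)"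
        by auto
      then show "((\<lambda>\<beta>. f (\<beta>, S u, u)) has_derivative blinfun_apply (partial_beta (f' (\<beta>, S u, u)))) (at \<beta> within Q)"
        by (simp only: partial[abs_def])
      show "onorm (blinfun_apply (partial_beta (f' (\<beta>, S u, u)))) \<le> C"
        using C[OF \<beta>Q u(1)] u(2) M1(2) by (simp add: norm_blinfun.rep_eq)
    qed (use \<beta> in auto)
    then show ?thesis by simp
  qed
  moreover have "0 \<le> C" unfolding C_def using L b0 \<open>0 \<le> M2\<close> by simp
  ultimately show ?thesis using that by blast
qed

text \<open>Test \<open>\<phi> \<beta>1\<close> with the optimal control for \<open>\<beta>2\<close>. All optimal controls lie in one ball, so one
  Lipschitz constant serves all of them.\<close>

lemma value_function_lipschitz:
  obtains C where "0 \<le> C" "\<And>\<beta>1 \<beta>2. \<beta>1 \<in> Q \<Longrightarrow> \<beta>2 \<in> Q \<Longrightarrow> \<phi> \<beta>1 \<le> \<phi> \<beta>2 + C * norm (\<beta>1 - \<beta>2)"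
proof -
  obtain K where K: "\<And>\<beta>. \<beta> \<in> Q \<Longrightarrow> \<phi> \<beta> \<le> K"
    using value_function_bounded_above by blast
  obtain M where M: "\<And>\<beta> u. \<beta> \<in> Q \<Longrightarrow> u \<in> Uad \<Longrightarrow> f (\<beta>, S u, u) \<le> K \<Longrightarrow> norm u \<le> M"
    using sublevel_controls_bounded[of K] by blast
  obtain C where C: "0 \<le> C" "\<And>\<beta>1 \<beta>2 u. \<beta>1 \<in> Q \<Longrightarrow> \<beta>2 \<in> Q \<Longrightarrow> u \<in> Uad \<Longrightarrow> norm u \<le> M \<Longrightarrow>
       \<bar>f (\<beta>1, S u, u) - f (\<beta>2, S u, u)\<bar> \<le> C * norm (\<beta>1 - \<beta>2)"
    using reduced_lipschitz_in_parameter[of M] by blast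
  have "\<phi> \<beta>1 \<le> \<phi> \<beta>2 + C * norm (\<beta>1 - \<beta>2)" if \<beta>: "\<beta>1 \<in> Q" "\<beta>2 \<in> Q" for \<beta>1 \<beta>2
  proof -
    obtain u where u: "u \<in> Uad" "f (\<beta>2, S u, u) = \<phi> \<beta>2"
      using value_function_attained[OF \<beta>(2)] by blast
    have "norm u \<le> M" using M[OF \<beta>(2) u(1)] K[OF \<beta>(2)] u(2) by simp
    then show ?thesis
      using C(2)[OF \<beta> u(1)] value_function_le[OF \<beta>(1) u(1)] u(2) by linarith
  qed
  then show ?thesis using that C(1) by blast
qed

text \<open>The relaxed constraint \<open>f \<le> \<xi>\<^sub>T\<close> exceeds the true one by at most a multiple of the diameter of
  \<open>T\<close>, and changing the parameter from \<open>\<beta>\<close> to \<open>\<beta>'\<close> costs at most a multiple of the distance. So \<open>u\<close>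
  is almost optimal for \<open>\<beta>'\<close>, and strong convexity bounds its distance to the optimal control.\<close>

lemma relaxed_control_near_optimal:
  obtains c where
    "\<And>T \<beta> u \<beta>' u'. int CARD('n) simplex T \<Longrightarrow> T \<subseteq> Q \<Longrightarrow> \<beta> \<in> T \<Longrightarrow> u \<in> Uad \<Longrightarrow>
       f (\<beta>, S u, u) \<le> vertex_interpolant \<phi> T \<beta> \<Longrightarrow> \<beta>' \<in> Q \<Longrightarrow> u' \<in> Uad \<Longrightarrow> f (\<beta>', S u', u') = \<phi> \<beta>' \<Longrightarrow>
       (norm (u - u'))\<^sup>2 \<le> c * (diameter T + norm (\<beta> - \<beta>'))"
proof -
  obtain K where K: "\<And>\<beta>. \<beta> \<in> Q \<Longrightarrow> \<phi> \<beta> \<le> K"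
    using value_function_bounded_above by blast
  obtain M where M: "\<And>\<beta> u. \<beta> \<in> Q \<Longrightarrow> u \<in> Uad \<Longrightarrow> f (\<beta>, S u, u) \<le> K \<Longrightarrow> norm u \<le> M"
    using sublevel_controls_bounded[of K] by blast
  obtain C1 where C1: "0 \<le> C1" "\<And>\<beta>1 \<beta>2 u. \<beta>1 \<in> Q \<Longrightarrow> \<beta>2 \<in> Q \<Longrightarrow> u \<in> Uad \<Longrightarrow> norm u \<le> M \<Longrightarrow>
       \<bar>f (\<beta>1, S u, u) - f (\<beta>2, S u, u)\<bar> \<le> C1 * norm (\<beta>1 - \<beta>2)"
    using reduced_lipschitz_in_parameter[of M] by blast
  obtain C2 where C2: "0 \<le> C2" "\<And>\<beta>1 \<beta>2. \<beta>1 \<in> Q \<Longrightarrow> \<beta>2 \<in> Q \<Longrightarrow> \<phi> \<beta>1 \<le> \<phi> \<beta>2 + C2 * norm (\<beta>1 - \<beta>2)"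
    using value_function_lipschitz by blast
  obtain \<mu> where \<mu>: "0 < \<mu>" "\<And>\<beta> u1 u2. \<beta> \<in> Q \<Longrightarrow> u1 \<in> Uad \<Longrightarrow> u2 \<in> Uad \<Longrightarrow>
       \<mu> * (norm (u1 - u2))\<^sup>2 \<le> f (\<beta>, S u1, u1) + f (\<beta>, S u2, u2) - 2 * \<phi> \<beta>"
    using midpoint_strong_convexity by blast
  have "(norm (u - u'))\<^sup>2 \<le> (C1 + C2) / \<mu> * (diameter T + norm (\<beta> - \<beta>'))"
    if T: "int CARD('n) simplex T" "T \<subseteq> Q" "\<beta> \<in> T"
      and u: "u \<in> Uad" "f (\<beta>, S u, u) \<le> vertex_interpolant \<phi> T \<beta>"
      and u': "\<beta>' \<in> Q" "u' \<in> Uad" "f (\<beta>', S u', u') = \<phi> \<beta>'" for T \<beta> u \<beta>' u'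
  proof -
    have \<beta>: "\<beta> \<in> Q" using T by blast
    have d: "0 \<le> diameter T"
      using diameter_ge_0[OF compact_imp_bounded[OF compact_simplex[OF T(1)]]] .
    have "vertex_interpolant \<phi> T \<beta> \<le> K"
      using vertex_interpolant_le[OF T(1,3)] K T(2) by blast
    then have "norm u \<le> M" using M[OF \<beta> u(1)] u(2) by simp
    then have "\<bar>f (\<beta>, S u, u) - f (\<beta>', S u, u)\<bar> \<le> C1 * norm (\<beta> - \<beta>')"
      by (rule C1(2)[OF \<beta> u'(1) u(1)])
    moreover have "vertex_interpolant \<phi> T \<beta> \<le> \<phi> \<beta> + C2 * diameter T"
      by (rule vertex_interpolant_le_lipschitz[OF T(1,3) _ C2(1)]) (use C2(2) T(2) \<beta> in blast)
    moreover have "\<phi> \<beta> \<le> \<phi> \<beta>' + C2 * norm (\<beta> - \<beta>')"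
      by (rule C2(2)[OF \<beta> u'(1)])
    moreover have "0 \<le> C1 * diameter T" using C1(1) d by simp
    ultimately have "\<mu> * (norm (u - u'))\<^sup>2 \<le> (C1 + C2) * (diameter T + norm (\<beta> - \<beta>'))"
      using \<mu>(2)[OF u'(1) u(1) u'(2)] u(2) u'(3) by (simp add: algebra_simps)
    then show ?thesis using \<mu>(1) by (simp add: field_simps)
  qed
  then show ?thesis using that by blast
qed

end

section \<open>The run of the algorithm\<close>

context global_solution_algorithm
begin

lemma run_invariant:
  assumes "reaches_iteration Uad A B f x k"
  shows "subdivision Q (\<T> k) \<and>
    (\<forall>T\<in>\<T> k. \<rho> \<le> aspect_ratio T \<and> subproblem_global_solution T Uad A B F f (sol k T))"
  using assms
proof (induction k)
  case 0
  then show ?case by (simp add: reaches_iteration_def)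
next
  case (Suc k)
  show ?case
  proof (cases "k = 0")
    case True
    have "\<rho> \<le> aspect_ratio T" if "T \<in> \<T> 1" for T
    proof -
      have "finite (aspect_ratio ` \<T> 1)" using init(2) by (simp add: subdivision_def)
      then have "Min (aspect_ratio ` \<T> 1) \<le> aspect_ratio T" using that by simp
      then show ?thesis using \<rho>(3) by linarith
    qed
    then show ?thesis
      using True init solve_new[OF Suc.prems] by simp
  next
    case False
    then have k: "reaches_iteration Uad A B f x k" "\<not> stop_test Uad A B f (x k)"
      using Suc.prems by (auto simp: reaches_iteration_def)
    note IH = Suc.IH[OF k(1)]
    obtain R where R: "subdivision (Tbar k) R" "\<T> (Suc k) = (\<T> k - {Tbar k}) \<union> R"
      using refine[OF k] by auto
    have "Tbar k \<in> \<T> k" using select[OF k(1)] by (simp add: is_arg_min_def)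
    then have "\<Union>(\<T> (Suc k)) = \<Union>(\<T> k)"
      using R by (auto simp: subdivision_def)
    then have "subdivision Q (\<T> (Suc k))"
      using IH R by (auto simp: subdivision_def)
    moreover have "\<rho> \<le> aspect_ratio T \<and> subproblem_global_solution T Uad A B F f (sol (Suc k) T)"
      if T: "T \<in> \<T> (Suc k)" for T
    proof (cases "T \<in> \<T> k")
      case True
      then show ?thesis using IH keep_old[OF Suc.prems, of T] T by simp
    next
      case False
      then show ?thesis
        using refine_quality[OF k, of T] solve_new[OF Suc.prems, of T] T by simp
    qed
    ultimately show ?thesis by blast
  qed
qed

lemma selected_in_subdivision:
  assumes "reaches_iteration Uad A B f x k"
  shows "Tbar k \<in> \<T> k" "int CARD('n) simplex Tbar k" "Tbar k \<subseteq> Q" "\<rho> \<le> aspect_ratio (Tbar k)"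
proof -
  show "Tbar k \<in> \<T> k" using select[OF assms] by (simp add: is_arg_min_def)
  then show "int CARD('n) simplex Tbar k" "Tbar k \<subseteq> Q" "\<rho> \<le> aspect_ratio (Tbar k)"
    using run_invariant[OF assms] unfolding subdivision_def by blast+
qed

lemma iterate_in_subproblem_feasible:
  assumes "reaches_iteration Uad A B f x k"
  shows "x k \<in> subproblem_feasible (Tbar k) Uad A B f"
  using run_invariant[OF assms] selected_in_subdivision(1)[OF assms] iterate[OF assms]
  unfolding subproblem_global_solution_def is_arg_min_def by metis

lemma never_stops_reaches:
  assumes nostop: "\<And>k. \<not> stops_at Uad A B f x k" and "1 \<le> k"
  shows "reaches_iteration Uad A B f x k" "\<not> stop_test Uad A B f (x k)"
proof -
  have "reaches_iteration Uad A B f x k \<and> \<not> stop_test Uad A B f (x k)"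
    using assms(2)
  proof (induction k rule: less_induct)
    case (less k)
    then have "reaches_iteration Uad A B f x k" by (simp add: reaches_iteration_def)
    then show ?case using nostop[of k] by (simp add: stops_at_def)
  qed
  then show "reaches_iteration Uad A B f x k" "\<not> stop_test Uad A B f (x k)" by auto
qed

text \<open>Once all selected simplices have volume at most \<open>e\<close>, every simplex created from then on has
  volume at most \<open>q * e\<close>. The simplices larger than \<open>q * e\<close> therefore form a finite set that only
  shrinks, and each selection of one of them removes it, so this happens finitely often. Induction
  starts with the volume of \<open>Q\<close>, which bounds all others.\<close>

lemma finitely_many_large_selections:
  assumes nostop: "\<And>k. \<not> stops_at Uad A B f x k"
  shows "finite {k. 1 \<le> k \<and> q ^ m * measure lebesgue Q < measure lebesgue (Tbar k)}"
proof (induction m)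
  case 0
  have "measure lebesgue (Tbar k) \<le> measure lebesgue Q" if "1 \<le> k" for k
  proof (rule measure_mono_fmeasurable)
    note sel = selected_in_subdivision[OF never_stops_reaches(1)[OF nostop that]]
    show "Tbar k \<subseteq> Q" by (rule sel)
    show "Tbar k \<in> sets lebesgue"
      using lmeasurable_compact[OF compact_simplex[OF sel(2)]] by (simp add: fmeasurableD)
    have "compact (\<Union>(\<T> 1))"
      using init(2) compact_simplex unfolding subdivision_def by (intro compact_Union) blast+
    then show "Q \<in> lmeasurable"
      using init(2) lmeasurable_compact unfolding subdivision_def by simp
  qed
  then have "{k. 1 \<le> k \<and> q ^ 0 * measure lebesgue Q < measure lebesgue (Tbar k)} = {}"
    by (auto simp: not_less)
  then show ?case by (simp only: finite.emptyI)
next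
  case (Suc m)
  let ?e = "q ^ m * measure lebesgue Q"
  let ?L = "\<lambda>k. {T \<in> \<T> k. q * ?e < measure lebesgue T}"
  obtain K where K: "\<And>k. k \<in> {k. 1 \<le> k \<and> ?e < measure lebesgue (Tbar k)} \<Longrightarrow> k < K"
    using finite_nat_set_iff_bounded[THEN iffD1, OF Suc.IH] by blast
  \<comment> \<open>Starting at \<open>Suc K\<close> keeps the index positive, as iterations are counted from 1.\<close>
  have drop: "?L (Suc k) \<subseteq> ?L k - {Tbar k}" if k: "Suc K \<le> k" for k
  proof
    fix T assume T: "T \<in> ?L (Suc k)"
    have "1 \<le> k" using k by simp
    note reach = never_stops_reaches[OF nostop this]
    have "measure lebesgue (Tbar k) \<le> ?e"
      using K[of k] k by force
    then have "q * measure lebesgue (Tbar k) \<le> q * ?e"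
      using q by simp
    then have "T \<in> \<T> k"
      using refine_quality[OF reach, of T] T by force
    moreover have "T \<noteq> Tbar k"
      using refine[OF reach] T by auto
    ultimately show "T \<in> ?L k - {Tbar k}" using T by simp
  qed
  have reach: "reaches_iteration Uad A B f x k" if "Suc K \<le> k" for k
    using never_stops_reaches(1)[OF nostop] that by simp
  have "finite (?L (Suc K))"
    using run_invariant[OF reach[OF order_refl]] by (simp add: subdivision_def)
  then have "finite {k. Suc K \<le> k \<and> Tbar k \<in> ?L k}"
    by (rule finite_drops) (rule drop)
  moreover have "{k. 1 \<le> k \<and> q ^ Suc m * measure lebesgue Q < measure lebesgue (Tbar k)}
      \<subseteq> {..K} \<union> {k. Suc K \<le> k \<and> Tbar k \<in> ?L k}"
    using selected_in_subdivision(1)[OF reach] by (auto simp: mult.assoc not_less_eq_eq)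
  ultimately show ?case
    using finite_subset by blast
qed

lemma selected_volume_tendsto_0:
  assumes nostop: "\<And>k. \<not> stops_at Uad A B f x k"
  shows "(\<lambda>k. measure lebesgue (Tbar k)) \<longlonglongrightarrow> 0"
proof (rule LIMSEQ_I)
  fix e :: real assume e: "0 < e"
  have "(\<lambda>m. q ^ m * measure lebesgue Q) \<longlonglongrightarrow> 0 * measure lebesgue Q"
    using q by (intro tendsto_intros LIMSEQ_power_zero) auto
  then have "\<forall>\<^sub>F m in sequentially. q ^ m * measure lebesgue Q < e"
    using e by (simp add: order_tendsto_iff)
  then obtain m where m: "q ^ m * measure lebesgue Q < e"
    using eventually_happens' sequentially_bot by blast
  obtain K where K: "\<And>k. k \<in> {k. 1 \<le> k \<and> q ^ m * measure lebesgue Q < measure lebesgue (Tbar k)} \<Longrightarrow> k < K"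
    using finite_nat_set_iff_bounded[THEN iffD1, OF finitely_many_large_selections[OF nostop, of m]] by blast
  have "norm (measure lebesgue (Tbar k) - 0) < e" if "Suc K \<le> k" for k
    using K[of k] that m by force
  then show "\<exists>K. \<forall>k\<ge>K. norm (measure lebesgue (Tbar k) - 0) < e" by blast
qed

lemma selected_diameter_tendsto_0:
  assumes nostop: "\<And>k. \<not> stops_at Uad A B f x k"
  shows "(\<lambda>k. diameter (Tbar k)) \<longlonglongrightarrow> 0"
proof -
  note sel = selected_in_subdivision[OF never_stops_reaches(1)[OF nostop]]
  have "(\<lambda>k. diameter (Tbar (Suc k))) \<longlonglongrightarrow> 0"
  proof (rule diameter_tendsto_0[OF _ \<rho>(1)])
    show "(\<lambda>k. measure lebesgue (Tbar (Suc k))) \<longlonglongrightarrow> 0"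
      using selected_volume_tendsto_0[OF nostop] by (rule LIMSEQ_Suc)
    show "compact (Tbar (Suc k))" for k
      by (rule compact_simplex[OF sel(2)]) simp
    show "\<rho> \<le> aspect_ratio (Tbar (Suc k))" for k
      by (rule sel(4)) simp
  qed
  then show ?thesis by (rule LIMSEQ_imp_Suc)
qed

end

section \<open>Convergence of the iterates\<close>

locale ovr_algorithm_run =
  ovr_setting Q Uad A B F F' f f' + global_solution_algorithm Q Uad A B F f q \<rho> \<T> sol Tbar x
  for Q :: "(real^'n::finite) set"
    and Uad :: "'u::{real_inner, complete_space} set"
    and A :: "'y::{real_inner, complete_space} \<Rightarrow>\<^sub>L ('y \<Rightarrow>\<^sub>L real)"
    and B :: "'u \<Rightarrow>\<^sub>L ('y \<Rightarrow>\<^sub>L real)"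
    and F F' f f' q \<rho> \<T> sol Tbar x
begin

text \<open>A feasible point \<open>z\<close> lies over some simplex of the current subdivision and satisfies the
  constraints of its subproblem, since \<open>\<phi> \<le> \<xi>\<^sub>T\<close> by convexity. The selected subproblem has the least
  optimal value.\<close>

lemma iterate_value_le:
  assumes reach: "reaches_iteration Uad A B f x k" and z: "z \<in> ovr_feasible Q Uad A B f"
  shows "F (x k) \<le> F z"
proof -
  obtain \<beta> y u where z_eq: "z = (\<beta>, y, u)" by (cases z)
  have zf: "\<beta> \<in> Q" "f (\<beta>, y, u) \<le> \<phi> \<beta>" "blinfun_apply A y - blinfun_apply B u = 0" "u \<in> Uad"
    using z by (auto simp: z_eq ovr_feasible_def)
  note inv = run_invariant[OF reach]
  obtain T where T: "T \<in> \<T> k" "\<beta> \<in> T" "T \<subseteq> Q" "int CARD('n) simplex T"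
    using inv zf(1) unfolding subdivision_def by blast
  have "f (\<beta>, y, u) - vertex_interpolant \<phi> T \<beta> \<le> 0"
    using convex_on_le_vertex_interpolant[OF T(4,3) convex_on_value_function T(2)] zf(2) by simp
  then have "z \<in> subproblem_feasible T Uad A B f"
    using zf T(2) by (simp add: z_eq subproblem_feasible_def)
  then have "F (sol k T) \<le> F z"
    using inv T(1) unfolding subproblem_global_solution_def is_arg_min_linorder by blast
  moreover have "F (sol k (Tbar k)) \<le> F (sol k T)"
    using select[OF reach] T(1) unfolding is_arg_min_linorder by blast
  ultimately show ?thesis using iterate[OF reach] by simp
qed

lemma iterate_components:
  assumes reach: "reaches_iteration Uad A B f x k"
  obtains \<beta> u where "x k = (\<beta>, S u, u)" "\<beta> \<in> Tbar k" "u \<in> Uad"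
    "f (\<beta>, S u, u) \<le> vertex_interpolant \<phi> (Tbar k) \<beta>"
proof -
  obtain \<beta> y u where x_eq: "x k = (\<beta>, y, u)" by (cases "x k")
  have "\<beta> \<in> Tbar k" "f (\<beta>, y, u) \<le> vertex_interpolant \<phi> (Tbar k) \<beta>"
    "blinfun_apply A y = blinfun_apply B u" "u \<in> Uad"
    using iterate_in_subproblem_feasible[OF reach] by (auto simp: x_eq subproblem_feasible_def)
  then show ?thesis using that x_eq by (simp add: state_equation_iff)
qed

lemma stopping_iterate_is_solution:
  assumes "stops_at Uad A B f x k"
  shows "ovr_global_solution Q Uad A B F f (x k)"
proof -
  have reach: "reaches_iteration Uad A B f x k" and stop: "f (x k) = \<phi> (fst (x k))"
    using assms by (auto simp: stops_at_def stop_test_def)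
  obtain \<beta> u where "x k = (\<beta>, S u, u)" "\<beta> \<in> Tbar k" "u \<in> Uad"
    using iterate_components[OF reach] by blast
  moreover have "blinfun_apply A (S u) = blinfun_apply B u" for u
    by (simp add: state_equation_iff)
  ultimately have "x k \<in> ovr_feasible Q Uad A B f"
    using stop selected_in_subdivision(3)[OF reach] by (auto simp: ovr_feasible_def)
  then show ?thesis
    using iterate_value_le[OF reach] by (simp add: ovr_global_solution_def is_arg_min_linorder)
qed

text \<open>Compactness of \<open>Q\<close> provides a limit of the parameters. The controls follow to the optimal
  control of the limit parameter because the diameters vanish, so the limit is feasible, and its
  objective value is a limit of lower bounds.\<close>

lemma subsequence_converges_to_solution:
  fixes r :: "nat \<Rightarrow> nat"
  assumes nostop: "\<And>k. \<not> stops_at Uad A B f x k" and r: "strict_mono r" "\<And>i. 1 \<le> r i"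
  shows "\<exists>s xbar. strict_mono s \<and> (\<lambda>i. x (r (s i))) \<longlonglongrightarrow> xbar \<and> ovr_global_solution Q Uad A B F f xbar"
proof -
  have reach: "reaches_iteration Uad A B f x (r i)" for i
    using never_stops_reaches(1)[OF nostop r(2)] .
  have "\<exists>\<beta> u. x (r i) = (\<beta>, S u, u) \<and> \<beta> \<in> Tbar (r i) \<and> u \<in> Uad \<and>
      f (\<beta>, S u, u) \<le> vertex_interpolant \<phi> (Tbar (r i)) \<beta>" for i
    using iterate_components[OF reach] by metis
  then obtain \<beta> u where xr: "\<And>i. x (r i) = (\<beta> i, S (u i), u i)"
    and \<beta>T: "\<And>i. \<beta> i \<in> Tbar (r i)" and uU: "\<And>i. u i \<in> Uad"
    and le: "\<And>i. f (\<beta> i, S (u i), u i) \<le> vertex_interpolant \<phi> (Tbar (r i)) (\<beta> i)"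
    by metis
  have \<beta>Q: "\<forall>i. \<beta> i \<in> Q"
    by (intro allI) (rule subsetD[OF selected_in_subdivision(3)[OF reach] \<beta>T])
  then obtain b s where b: "b \<in> Q" and s: "strict_mono s" and lim\<beta>: "(\<lambda>i. \<beta> (s i)) \<longlonglongrightarrow> b"
    using compact_Q[unfolded compact_def, THEN spec, of \<beta>] unfolding o_def by blast
  obtain w where w: "w \<in> Uad" "f (b, S w, w) = \<phi> b"
    using value_function_attained[OF b] by blast
  obtain c where c: "\<And>T \<beta> u \<beta>' u'. int CARD('n) simplex T \<Longrightarrow> T \<subseteq> Q \<Longrightarrow> \<beta> \<in> T \<Longrightarrow> u \<in> Uad \<Longrightarrow>
       f (\<beta>, S u, u) \<le> vertex_interpolant \<phi> T \<beta> \<Longrightarrow> \<beta>' \<in> Q \<Longrightarrow> u' \<in> Uad \<Longrightarrow> f (\<beta>', S u', u') = \<phi> \<beta>' \<Longrightarrow>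
       (norm (u - u'))\<^sup>2 \<le> c * (diameter T + norm (\<beta> - \<beta>'))"
    using relaxed_control_near_optimal by blast
  have dist_le: "norm (u (s i) - w) \<le> sqrt (c * (diameter (Tbar (r (s i))) + norm (\<beta> (s i) - b)))" for i
    by (rule real_le_rsqrt)
      (rule c[OF selected_in_subdivision(2,3)[OF reach] \<beta>T uU le b w])
  have "strict_mono (r \<circ> s)" using r(1) s by (rule strict_mono_o)
  from LIMSEQ_subseq_LIMSEQ[OF selected_diameter_tendsto_0[OF nostop] this]
  have "(\<lambda>i. diameter (Tbar (r (s i)))) \<longlonglongrightarrow> 0" by (simp add: o_def)
  then have "(\<lambda>i. sqrt (c * (diameter (Tbar (r (s i))) + norm (\<beta> (s i) - b)))) \<longlonglongrightarrow> sqrt (c * (0 + norm (b - b)))"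
    using lim\<beta> by (intro tendsto_intros)
  then have bound_lim: "(\<lambda>i. sqrt (c * (diameter (Tbar (r (s i))) + norm (\<beta> (s i) - b)))) \<longlonglongrightarrow> 0"
    by simp
  have "(\<lambda>i. u (s i) - w) \<longlonglongrightarrow> 0"
    by (rule Lim_null_comparison[OF always_eventually bound_lim]) (use dist_le in blast)
  then have limu: "(\<lambda>i. u (s i)) \<longlonglongrightarrow> w" by (rule LIM_zero_cancel)
  have limx: "(\<lambda>i. x (r (s i))) \<longlonglongrightarrow> (b, S w, w)"
    unfolding xr by (intro tendsto_Pair lim\<beta> limu bounded_linear.tendsto[OF bounded_linear_S])
  have "blinfun_apply A (S w) = blinfun_apply B w"
    by (simp add: state_equation_iff)
  then have feas: "(b, S w, w) \<in> ovr_feasible Q Uad A B f"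
    using b w by (simp add: ovr_feasible_def)
  have "(\<lambda>i. F (x (r (s i)))) \<longlonglongrightarrow> F (b, S w, w)"
  proof (rule continuous_on_tendsto_compose[OF continuous_on_objectives(1) limx])
    show "(b, S w, w) \<in> Q \<times> UNIV \<times> UNIV" using b by simp
    show "\<forall>\<^sub>F i in sequentially. x (r (s i)) \<in> Q \<times> UNIV \<times> UNIV"
      using \<beta>Q by (simp add: xr)
  qed
  then have "F (b, S w, w) \<le> F z" if "z \<in> ovr_feasible Q Uad A B f" for z
    by (rule LIMSEQ_le_const2) (use iterate_value_le[OF reach that] in blast)
  then have "ovr_global_solution Q Uad A B F f (b, S w, w)"
    using feas by (simp add: ovr_global_solution_def is_arg_min_linorder)
  then show ?thesis using s limx by blast
qed

lemma iterates_converge_to_unique_solution: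
  assumes nostop: "\<And>k. \<not> stops_at Uad A B f x k"
    and unique: "\<And>z. ovr_global_solution Q Uad A B F f z \<Longrightarrow> z = xbar"
  shows "x \<longlonglongrightarrow> xbar"
proof (rule ccontr)
  assume "\<not> x \<longlonglongrightarrow> xbar"
  then obtain e where e: "0 < e" "\<And>N. \<exists>k\<ge>N. e \<le> dist (x k) xbar"
    unfolding lim_sequentially by (meson not_less)
  have "infinite {k. 1 \<le> k \<and> e \<le> dist (x k) xbar}"
    unfolding infinite_nat_iff_unbounded_le
  proof
    fix N
    obtain k where "k \<ge> Suc N" "e \<le> dist (x k) xbar" using e(2) by blast
    then show "\<exists>k\<ge>N. k \<in> {k. 1 \<le> k \<and> e \<le> dist (x k) xbar}"
      by (intro exI[of _ k]) simp
  qed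
  then obtain r :: "nat \<Rightarrow> nat" where r: "strict_mono r" "\<And>i. r i \<in> {k. 1 \<le> k \<and> e \<le> dist (x k) xbar}"
    using infinite_enumerate by blast
  have "\<And>i. 1 \<le> r i" using r(2) by simp
  then obtain s z where z: "(\<lambda>i. x (r (s i))) \<longlonglongrightarrow> z" "ovr_global_solution Q Uad A B F f z"
    using subsequence_converges_to_solution[OF nostop r(1)] by blast
  have "(\<lambda>i. dist (x (r (s i))) xbar) \<longlonglongrightarrow> dist z xbar"
    using z(1) by (intro tendsto_intros)
  then have "e \<le> dist z xbar"
    by (rule LIMSEQ_le_const) (use r(2) in blast)
  then show False using unique[OF z(2)] e(1) by simp
qed

end

theorem theorem3p1:
  fixes Q :: "(real^'n::finite) set"
    and Uad :: "'u::{real_inner, complete_space} set"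
    and A :: "'y::{real_inner, complete_space} \<Rightarrow>\<^sub>L ('y \<Rightarrow>\<^sub>L real)"
    and B :: "'u \<Rightarrow>\<^sub>L ('y \<Rightarrow>\<^sub>L real)"
    and F f :: "(real^'n) \<times> 'y \<times> 'u \<Rightarrow> real"
    and F' f' :: "(real^'n) \<times> 'y \<times> 'u \<Rightarrow> (((real^'n) \<times> 'y \<times> 'u) \<Rightarrow>\<^sub>L real)"
    and q \<rho> :: real
    and \<T> :: "nat \<Rightarrow> (real^'n) set set"
    and sol :: "nat \<Rightarrow> (real^'n) set \<Rightarrow> (real^'n) \<times> 'y \<times> 'u"
    and Tbar :: "nat \<Rightarrow> (real^'n) set"
    and x :: "nat \<Rightarrow> (real^'n) \<times> 'y \<times> 'u"
  assumes "ovr_setting Q Uad A B F F' f f'"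
    and "global_solution_algorithm Q Uad A B F f q \<rho> \<T> sol Tbar x"
  shows "((\<exists>k. stops_at Uad A B f x k \<and> ovr_global_solution Q Uad A B F f (x k)) \<or>
          ((\<forall>k. \<not> stops_at Uad A B f x k) \<and>
           (\<exists>r xbar. strict_mono r \<and> (\<forall>i::nat. 1 \<le> r i) \<and> (\<lambda>i. x (r i)) \<longlonglongrightarrow> xbar \<and>
              ovr_global_solution Q Uad A B F f xbar))) \<and>
         (\<forall>xbar. ovr_global_solution Q Uad A B F f xbar \<and>
              (\<forall>z. ovr_global_solution Q Uad A B F f z \<longrightarrow> z = xbar) \<and>
              (\<forall>k. \<not> stops_at Uad A B f x k) \<longrightarrow>
            x \<longlonglongrightarrow> xbar)"
proof -
  interpret ovr_algorithm_run Q Uad A B F F' f f' q \<rho> \<T> sol Tbar x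
    using assms by (rule ovr_algorithm_run.intro)
  show ?thesis
  proof (intro conjI allI impI)
    show "(\<exists>k. stops_at Uad A B f x k \<and> ovr_global_solution Q Uad A B F f (x k)) \<or>
        ((\<forall>k. \<not> stops_at Uad A B f x k) \<and>
         (\<exists>r xbar. strict_mono r \<and> (\<forall>i::nat. 1 \<le> r i) \<and> (\<lambda>i. x (r i)) \<longlonglongrightarrow> xbar \<and>
            ovr_global_solution Q Uad A B F f xbar))"
    proof (cases "\<exists>k. stops_at Uad A B f x k")
      case True
      then show ?thesis using stopping_iterate_is_solution by blast
    next
      case False
      \<comment> \<open>The shift by one skips index 0, where there is no iterate.\<close>
      have "\<exists>s xbar. strict_mono s \<and> (\<lambda>i. x (Suc (s i))) \<longlonglongrightarrow> xbar \<and> ovr_global_solution Q Uad A B F f xbar"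
        using subsequence_converges_to_solution[of Suc] False by (simp add: strict_mono_Suc_iff)
      then obtain s xbar where s: "strict_mono s" "(\<lambda>i. x (Suc (s i))) \<longlonglongrightarrow> xbar"
        "ovr_global_solution Q Uad A B F f xbar" by blast
      have "strict_mono (\<lambda>i. Suc (s i))" using s(1) by (simp add: strict_mono_def)
      with s(2,3) False show ?thesis
        by (intro disjI2 conjI exI[of _ "\<lambda>i. Suc (s i)"] exI[of _ xbar]) auto
    qed
  next
    fix xbar
    assume "ovr_global_solution Q Uad A B F f xbar \<and>
      (\<forall>z. ovr_global_solution Q Uad A B F f z \<longrightarrow> z = xbar) \<and> (\<forall>k. \<not> stops_at Uad A B f x k)"
    then show "x \<longlonglongrightarrow> xbar"
      by (intro iterates_converge_to_unique_solution) auto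
  qed
qed

end
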